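(* Consider a pairwise comparison system with best criteria $b_1,\dots,b_{n_1}$ and worst criteria $w_1,\dots,w_{n_2}$, let $b=b_1$, $w=w_1$, $D=C\setminus\{b,w\}$, $D'=C\setminus\{b_1,\dots,b_{n_1},w_1,\dots,w_{n_2}\}$, and let $D_1,D_2,\epsilon_i,\epsilon_{i,j}$ ($i,j\in D$) be as defined in the context. Let $\epsilon^*$ be the optimal objective value of $$\min\ \epsilon\quad\text{s.t.}\quad \left|\frac{w_{b_1}}{w_i}-a_{bi}\right|\le\epsilon,\ \left|\frac{w_i}{w_{w_1}}-a_{iw}\right|\le\epsilon,\ \left|\frac{w_{b_1}}{w_{w_1}}-a_{bw}\right|\le\epsilon,\ n_1w_{b_1}+n_2w_{w_1}+\sum_{k\in D'}w_k=1,\ w_j\ge0\ \text{ for all } i\in D',\ j\in C.$$ For a real number $P$ and $i\in D'$ put $$\alpha_i(P)=\frac{a_{bi}-a_{iw}+\sqrt{(a_{bi}+a_{iw})^2-4a_{bi}a_{iw}+4P}}{2},\qquad \beta_i(P)=\frac{-a_{bi}+a_{iw}+\sqrt{(a_{bi}+a_{iw})^2-4a_{bi}a_{iw}+4P}}{2},$$ and let $S'(P)$ denote the pair $(\tilde A_b,\tilde A_w)$ given by $\tilde a_{bw}=P$, $\tilde a_{bi}=\alpha_i(P)$, $\tilde a_{iw}=\beta_i(P)$ for all $i\in D'$ (and $\tilde a_{bb}=\tilde a_{ww}=1$). Then the following hold. 1. If $\epsilon^*=\epsilon_{i_0}$ for some $i_0\in D_1$, then $S'(a_{bw}-\epsilon_{i_0})$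 is the only best optimally modified PCS. 2. If $\epsilon^*=\epsilon_{j_0}$ for some $j_0\in D_2$, then $S'(a_{bw}+\epsilon_{j_0})$ is the only best optimally modified PCS. 3. If $\epsilon^*=\epsilon_{i_0,j_0}$ for some $i_0,j_0\in D$, then $S'\big((a_{bi_0}+\epsilon_{i_0,j_0})(a_{i_0w}+\epsilon_{i_0,j_0})\big)$ is the only best optimally modified PCS.
   Context: $C=\{1,\dots,n\}$ is the set of criteria. There are $n_1\ge1$ equally preferred best criteria $b_1,\dots,b_{n_1}$ and $n_2\ge1$ equally preferred worst criteria $w_1,\dots,w_{n_2}$, all distinct, with $n_1\ge2$ or $n_2\ge2$. The number $a_{ij}$ is the relative preference of criterion $i$ over criterion $j$. Equal preference means that $a_{b_ki}=a_{bi}$, $a_{iw_l}=a_{iw}$, $a_{b_kw_l}=a_{bw}$ do not depend on $k,l$ (for $i\in D'$), that $a_{bb_k}=1$, $a_{b_kw}=a_{bw}$ for all $k$, and $a_{w_lw}=1$, $a_{bw_l}=a_{bw}$ for all $l$. All these are real numbers with $1\le a_{bi},a_{iw}\le a_{bw}$ for all $i\in D$. In the weight problem, the variable $w_j$ is the weight of criterion $j$ (so $w_{b_1}$ and $w_{w_1}$ are the weights of the criteria $b_1$ and $w_1$), and denominators are required to be nonzero. $D_1=\{i\in D:a_{bi}a_{iw}<a_{bw}\}$, $D_2=\{i\in D:a_{bi}a_{iw}>a_{bw}\}$, and for $i,j\in D$ $$\epsilon_i=\left|\frac{a_{bi}+a_{iw}+1-\sqrt{(a_{bi}+a_{iw}+1)^2-4(a_{bi}a_{iw}-a_{bw})}}{2}\right|,\qquad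 \epsilon_{i,j}=\left|\frac{a_{bi}a_{iw}-a_{bj}a_{jw}}{a_{bi}+a_{iw}+a_{bj}+a_{jw}}\right|.$$ Optimally modified PCS: consider the problem $$\min\ \eta\quad\text{s.t.}\quad |\tilde a_{bi}-a_{bi}|\le\eta,\ |\tilde a_{iw}-a_{iw}|\le\eta,\ |\tilde a_{bw}-a_{bw}|\le\eta,\ \tilde a_{bi}\tilde a_{iw}=\tilde a_{bw},\ \tilde a_{bi},\tilde a_{iw},\tilde a_{bw}\ge0\ \text{ for all } i\in D'.$$ The entries $\tilde a_{bi},\tilde a_{iw}$ ($i\in D'$), $\tilde a_{bw}$ of an optimal solution, completed by $\tilde a_{bb}=\tilde a_{ww}=1$, form an optimally modified PCS. A best optimally modified PCS is an optimally modified PCS which, for every $i\in D'\cup\{b,w\}$ simultaneously, has the minimum value of $\max\{|\tilde a_{bi}-a_{bi}|,|\tilde a_{iw}-a_{iw}|\}$ among all optimally modified PCS.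
   Formalization: In claim 3 the pair is labelled so that a_{bi_0}a_{i_0w} ≤ a_{bj_0}a_{j_0w}; with the opposite strict order the claim is false (e.g. a_{bw}=8, D' entries (2,2) and (4,4): the true value is 9, the formula gives 25). *)

theory Defs
  imports Complex_Main "HOL-Library.FuncSet"
begin

text \<open>
  The criteria are \<open>1, \<dots>, num_crit\<close>; the best ones are \<open>bst 1, \<dots>, bst num_best\<close> and the worst ones
  \<open>wst 1, \<dots>, wst num_worst\<close>. \<open>pref i j\<close> is the preference of \<open>i\<close> over \<open>j\<close>.
\<close>

record comparison_system =
  num_crit :: nat
  num_best :: nat
  num_worst :: nat
  bst :: "nat \<Rightarrow> nat"
  wst :: "nat \<Rightarrow> nat"
  pref :: "nat \<Rightarrow> nat \<Rightarrow> real"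

definition C :: "comparison_system \<Rightarrow> nat set" where
  "C S = {1..num_crit S}"

abbreviation b :: "comparison_system \<Rightarrow> nat" where
  "b S \<equiv> bst S 1"

abbreviation w :: "comparison_system \<Rightarrow> nat" where
  "w S \<equiv> wst S 1"

abbreviation a_bw :: "comparison_system \<Rightarrow> real" where
  "a_bw S \<equiv> pref S (b S) (w S)"

abbreviation a_b :: "comparison_system \<Rightarrow> nat \<Rightarrow> real" where
  "a_b S i \<equiv> pref S (b S) i"

abbreviation a_w :: "comparison_system \<Rightarrow> nat \<Rightarrow> real" where
  "a_w S i \<equiv> pref S i (w S)"

definition D :: "comparison_system \<Rightarrow> nat set" where
  "D S = C S - {b S, w S}"

definition D' :: "comparison_system \<Rightarrow> nat set" where
  "D' S = C S - (bst S ` {1..num_best S} \<union> wst S ` {1..num_worst S})"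

definition valid_system :: "comparison_system \<Rightarrow> bool" where
  "valid_system S \<longleftrightarrow>
     num_best S \<ge> 1 \<and> num_worst S \<ge> 1 \<and> (num_best S \<ge> 2 \<or> num_worst S \<ge> 2) \<and>
     bst S ` {1..num_best S} \<subseteq> C S \<and> wst S ` {1..num_worst S} \<subseteq> C S \<and>
     inj_on (bst S) {1..num_best S} \<and> inj_on (wst S) {1..num_worst S} \<and>
     bst S ` {1..num_best S} \<inter> wst S ` {1..num_worst S} = {} \<and>
     (\<forall>k\<in>{1..num_best S}. \<forall>i\<in>D' S. pref S (bst S k) i = a_b S i) \<and>
     (\<forall>l\<in>{1..num_worst S}. \<forall>i\<in>D' S. pref S i (wst S l) = a_w S i) \<and>
     (\<forall>k\<in>{1..num_best S}. \<forall>l\<in>{1..num_worst S}. pref S (bst S k) (wst S l) = a_bw S) \<and>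
     (\<forall>k\<in>{1..num_best S}. a_b S (bst S k) = 1 \<and> a_w S (bst S k) = a_bw S) \<and>
     (\<forall>l\<in>{1..num_worst S}. a_w S (wst S l) = 1 \<and> a_b S (wst S l) = a_bw S) \<and>
     (\<forall>i\<in>D S. 1 \<le> a_b S i \<and> a_b S i \<le> a_bw S \<and> 1 \<le> a_w S i \<and> a_w S i \<le> a_bw S)"

definition D\<^sub>1 :: "comparison_system \<Rightarrow> nat set" where
  "D\<^sub>1 S = {i \<in> D S. a_b S i * a_w S i < a_bw S}"

definition D\<^sub>2 :: "comparison_system \<Rightarrow> nat set" where
  "D\<^sub>2 S = {i \<in> D S. a_b S i * a_w S i > a_bw S}"

definition eps1 :: "comparison_system \<Rightarrow> nat \<Rightarrow> real" where
  "eps1 S i = \<bar>(a_b S i + a_w S i + 1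
      - sqrt ((a_b S i + a_w S i + 1)\<^sup>2 - 4 * (a_b S i * a_w S i - a_bw S))) / 2\<bar>"

text \<open>
  \<open>eps2\<close> is symmetric in its two indices, but the modified system built from the value
  \<open>(a_b S i + eps2 S i j) * (a_w S i + eps2 S i j)\<close> is not: it is meant for the labelling of the pair
  in which \<open>i\<close> has the smaller product \<open>a_b S i * a_w S i\<close>.
\<close>

definition eps2 :: "comparison_system \<Rightarrow> nat \<Rightarrow> nat \<Rightarrow> real" where
  "eps2 S i j = \<bar>(a_b S i * a_w S i - a_b S j * a_w S j)
      / (a_b S i + a_w S i + a_b S j + a_w S j)\<bar>"

definition weight_feasible :: "comparison_system \<Rightarrow> (nat \<Rightarrow> real) \<Rightarrow> real \<Rightarrow> bool" where
  "weight_feasible S x e \<longleftrightarrow>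
     (\<forall>i\<in>D' S. x i \<noteq> 0 \<and> \<bar>x (b S) / x i - a_b S i\<bar> \<le> e \<and> \<bar>x i / x (w S) - a_w S i\<bar> \<le> e) \<and>
     x (w S) \<noteq> 0 \<and> \<bar>x (b S) / x (w S) - a_bw S\<bar> \<le> e \<and>
     real (num_best S) * x (b S) + real (num_worst S) * x (w S) + (\<Sum>k\<in>D' S. x k) = 1 \<and>
     (\<forall>j\<in>C S. x j \<ge> 0)"

definition eps_star :: "comparison_system \<Rightarrow> real" where
  "eps_star S = (LEAST e. \<exists>x. weight_feasible S x e)"

text \<open>
  Below, \<open>u i\<close>, \<open>v i\<close> and \<open>p\<close> are the modified values of \<open>a_b S i\<close>, \<open>a_w S i\<close> and \<open>a_bw S\<close>.
  The constraints on \<open>p\<close> alone are imposed even if \<open>D' S\<close> is empty.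
\<close>

definition mod_feasible ::
    "comparison_system \<Rightarrow> (nat \<Rightarrow> real) \<Rightarrow> (nat \<Rightarrow> real) \<Rightarrow> real \<Rightarrow> real \<Rightarrow> bool" where
  "mod_feasible S u v p \<eta> \<longleftrightarrow>
     (\<forall>i\<in>D' S. \<bar>u i - a_b S i\<bar> \<le> \<eta> \<and> \<bar>v i - a_w S i\<bar> \<le> \<eta> \<and> u i * v i = p \<and>
                u i \<ge> 0 \<and> v i \<ge> 0) \<and>
     \<bar>p - a_bw S\<bar> \<le> \<eta> \<and> p \<ge> 0"

definition mod_optimal ::
    "comparison_system \<Rightarrow> (nat \<Rightarrow> real) \<Rightarrow> (nat \<Rightarrow> real) \<Rightarrow> real \<Rightarrow> real \<Rightarrow> bool" where
  "mod_optimal S u v p \<eta> \<longleftrightarrow> mod_feasible S u v p \<eta> \<and>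
     (\<forall>u' v' p' \<eta>'. mod_feasible S u' v' p' \<eta>' \<longrightarrow> \<eta> \<le> \<eta>')"

text \<open>
  A modified system is a pair of vectors (comparisons of the best criterion with the others, and of
  the others with the worst one) indexed by \<open>D' S \<union> {b S, w S}\<close>. The vectors are \<open>undefined\<close>
  off the index set, so that equality of modified systems is equality of all entries.
\<close>

type_synonym mod_system = "(nat \<Rightarrow> real) \<times> (nat \<Rightarrow> real)"

definition idx :: "comparison_system \<Rightarrow> nat set" where
  "idx S = D' S \<union> {b S, w S}"

definition mk_system ::
    "comparison_system \<Rightarrow> (nat \<Rightarrow> real) \<Rightarrow> (nat \<Rightarrow> real) \<Rightarrow> real \<Rightarrow> mod_system" where
  "mk_system S u v p =
     (\<lambda>i\<in>idx S. if i = b S then 1 else if i = w S then p else u i,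
      \<lambda>i\<in>idx S. if i = b S then p else if i = w S then 1 else v i)"

definition optimally_modified :: "comparison_system \<Rightarrow> mod_system \<Rightarrow> bool" where
  "optimally_modified S A \<longleftrightarrow> (\<exists>u v p \<eta>. mod_optimal S u v p \<eta> \<and> A = mk_system S u v p)"

definition deviation :: "comparison_system \<Rightarrow> mod_system \<Rightarrow> nat \<Rightarrow> real" where
  "deviation S A i = max \<bar>fst A i - a_b S i\<bar> \<bar>snd A i - a_w S i\<bar>"

definition best_optimally_modified :: "comparison_system \<Rightarrow> mod_system \<Rightarrow> bool" where
  "best_optimally_modified S A \<longleftrightarrow> optimally_modified S A \<and>
     (\<forall>i\<in>idx S. \<forall>A'. optimally_modified S A' \<longrightarrow> deviation S A i \<le> deviation S A' i)"

definition only_best_optimally_modified :: "comparison_system \<Rightarrow> mod_system \<Rightarrow> bool" where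
  "only_best_optimally_modified S A \<longleftrightarrow> (\<forall>A'. best_optimally_modified S A' \<longleftrightarrow> A' = A)"

definition \<alpha> :: "comparison_system \<Rightarrow> real \<Rightarrow> nat \<Rightarrow> real" where
  "\<alpha> S P i = (a_b S i - a_w S i
      + sqrt ((a_b S i + a_w S i)\<^sup>2 - 4 * a_b S i * a_w S i + 4 * P)) / 2"

definition \<beta> :: "comparison_system \<Rightarrow> real \<Rightarrow> nat \<Rightarrow> real" where
  "\<beta> S P i = (- a_b S i + a_w S i
      + sqrt ((a_b S i + a_w S i)\<^sup>2 - 4 * a_b S i * a_w S i + 4 * P)) / 2"

definition S' :: "comparison_system \<Rightarrow> real \<Rightarrow> mod_system" where
  "S' S P = mk_system S (\<alpha> S P) (\<beta> S P) P"

end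

theory Submission
  imports Defs
begin

text \<open>
  Fix the modified value \<open>p\<close> of \<open>a_bw\<close>. The criteria in \<open>D'\<close> then decouple: for each of them one
  looks for nonnegative \<open>u\<close>, \<open>v\<close> with product \<open>p\<close> that are close to \<open>a = a_b S i\<close> and \<open>c = a_w S i\<close>
  in the maximum norm. Increasing both entries increases the product, so the closest pair moves both
  entries by the same amount \<open>t\<close>, where \<open>(a + t) * (c + t) = p\<close>, and for \<open>p > 0\<close> no other pair is
  as close (\<open>shift_minimal\<close>, \<open>shift_unique\<close>). The closest pair is \<open>(\<alpha> S p i, \<beta> S p i)\<close>.
  Hence \<open>S' S p\<close> has, for this \<open>p\<close>, the least deviation at all criteria at once. So, as soon as all
  optimally modified systems share one value \<open>P\<close> of \<open>p\<close>, the system \<open>S' S P\<close> is the only best one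
  (\<open>only_best_if_forced\<close>).

  It remains to see that the optimal \<open>p\<close> is forced in each of the three cases. For every feasible
  solution with value \<open>\<eta>\<close>, each \<open>i\<close> in \<open>D\<close> gives
  \<open>(a_b S i - \<eta>) * (a_w S i - \<eta>) \<le> p \<le> (a_b S i + \<eta>) * (a_w S i + \<eta>)\<close>
  (\<open>feasible_le_upper\<close>, \<open>feasible_ge_lower\<close>; the left inequality for \<open>\<eta> \<le> a_b S i, a_w S i\<close>), besides
  \<open>\<bar>p - a_bw S\<bar> \<le> \<eta>\<close>. The numbers \<open>eps1 S i\<close> and \<open>eps2 S i j\<close> are exactly the values of \<open>\<eta>\<close> at which
  an upper bound from this list meets a lower bound (\<open>eps1_D\<^sub>1\<close>, \<open>eps1_D\<^sub>2\<close>, \<open>eps2_ordered\<close>).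
  If the optimal value is one of them, then \<open>p\<close> is squeezed to the common value of the two bounds.

  Finally, the optimal value of the weight problem, which is defined as a least element, has to be
  shown to exist and to agree with the optimal value of the modification problem. Quotients of
  weights are feasible modifications, and a modification with \<open>p > 0\<close> comes from weights. The least
  value of the objective for given \<open>p\<close> is continuous in \<open>p\<close>, and its minimum can be sought over a
  compact interval starting at \<open>1\<close>, since all products \<open>a_b S i * a_w S i\<close> and \<open>a_bw S\<close> are at least
  \<open>1\<close> (\<open>optimum_exists\<close>). So the minimum is attained, at a positive \<open>p\<close>.
\<close>

section \<open>The closest pair with a given product\<close>

(* The criterion b S is bst S 1; facts about it match only while 1 is not rewritten to Suc 0. *)
declare One_nat_def [simp del]

text \<open>
  The larger root \<open>t\<close> of \<open>(a + t) * (c + t) = p\<close>; for \<open>p \<ge> 0\<close>, both factors at the smaller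
  root are nonpositive.
\<close>

definition shift :: "real \<Rightarrow> real \<Rightarrow> real \<Rightarrow> real" where
  "shift a c p = (sqrt ((a - c)\<^sup>2 + 4 * p) - (a + c)) / 2"

lemma abs_diff_le_sqrt:
  fixes a c p :: real
  assumes "0 \<le> p"
  shows "\<bar>a - c\<bar> \<le> sqrt ((a - c)\<^sup>2 + 4 * p)"
  using assms by (intro real_le_rsqrt) simp

lemma abs_diff_less_sqrt:
  fixes a c p :: real
  assumes "0 < p"
  shows "\<bar>a - c\<bar> < sqrt ((a - c)\<^sup>2 + 4 * p)"
  using assms by (intro real_less_rsqrt) simp

lemma shifted_product:
  assumes "0 \<le> p"
  shows "(a + shift a c p) * (c + shift a c p) = p"
proof -
  define r where "r = sqrt ((a - c)\<^sup>2 + 4 * p)"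
  have "r\<^sup>2 = (a - c)\<^sup>2 + 4 * p"
    unfolding r_def using assms by simp
  then show ?thesis
    unfolding shift_def r_def[symmetric] by (simp add: field_simps power2_eq_square)
qed

lemma shifted_nonneg:
  assumes "0 \<le> p"
  shows "0 \<le> a + shift a c p" and "0 \<le> c + shift a c p"
  using abs_diff_le_sqrt[OF assms, of a c] unfolding shift_def by (simp_all add: field_simps)

lemma shifted_pos:
  assumes "0 < p"
  shows "0 < a + shift a c p" and "0 < c + shift a c p"
  using abs_diff_less_sqrt[OF assms, of a c] unfolding shift_def by (simp_all add: field_simps)

lemma shift_mono: "p \<le> q \<Longrightarrow> shift a c p \<le> shift a c q"
  unfolding shift_def by simp

lemma shift_nonpos:
  assumes "0 \<le> p" "p \<le> a * c" "0 \<le> a" "0 \<le> c"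
  shows "shift a c p \<le> 0"
proof -
  have "sqrt ((a - c)\<^sup>2 + 4 * p) \<le> a + c"
    using assms by (intro real_le_lsqrt) (auto simp: power2_eq_square algebra_simps)
  then show ?thesis unfolding shift_def by simp
qed

lemma continuous_shift: "continuous_on A (shift a c)"
  unfolding shift_def by (intro continuous_intros) simp

text \<open>
  If both entries stay strictly below their shifted values, or both strictly above them, then their
  product cannot be \<open>p\<close>.
\<close>

lemma shift_minimal:
  assumes "0 \<le> u" "0 \<le> v" "u * v = p" "\<bar>u - a\<bar> \<le> \<eta>" "\<bar>v - c\<bar> \<le> \<eta>"
  shows "\<bar>shift a c p\<bar> \<le> \<eta>"
proof (rule ccontr)
  assume *: "\<not> \<bar>shift a c p\<bar> \<le> \<eta>"
  have p: "0 \<le> p" using assms by auto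
  note s = shifted_nonneg(1)[OF p, of a c] shifted_nonneg(2)[OF p, of c a] shifted_product[OF p, of a c]
  from * consider "\<eta> < shift a c p" | "shift a c p < - \<eta>" by linarith
  then show False
  proof cases
    case 1
    then have "u * v < (a + shift a c p) * (c + shift a c p)"
      using assms by (intro mult_strict_mono') auto
    then show False using s assms by simp
  next
    case 2
    then have "(a + shift a c p) * (c + shift a c p) < u * v"
      using assms s by (intro mult_strict_mono') auto
    then show False using s assms by simp
  qed
qed

lemma factors_le_imp_eq:
  fixes u v x y :: real
  assumes "0 < u" "0 < v" "u \<le> x" "v \<le> y" "u * v = x * y"
  shows "u = x" "v = y"
proof -
  have "x * y - u * v = (x - u) * y + u * (y - v)" by algebra
  moreover have "0 \<le> (x - u) * y" "0 \<le> u * (y - v)" using assms by auto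
  ultimately have "(x - u) * y = 0" "u * (y - v) = 0" using assms(5) by linarith+
  then show "u = x" "v = y" using assms by auto
qed

text \<open>
  A pair at distance \<open>\<bar>shift a c p\<bar>\<close> lies entrywise on one side of the shifted pair, and comparable
  positive pairs with the same product coincide. For \<open>p = 0\<close> one of the entries could vanish
  and leave the other one free.
\<close>

lemma shift_unique:
  assumes "0 \<le> u" "0 \<le> v" "u * v = p" "0 < p"
    and "\<bar>u - a\<bar> \<le> \<bar>shift a c p\<bar>" "\<bar>v - c\<bar> \<le> \<bar>shift a c p\<bar>"
  shows "u = a + shift a c p" "v = c + shift a c p"
proof -
  define s where "s = shift a c p"
  have pos: "0 < a + s" "0 < c + s" and prod: "(a + s) * (c + s) = p"
    using shifted_pos(1)[OF \<open>0 < p\<close>, of a c] shifted_pos(2)[OF \<open>0 < p\<close>, of c a] shifted_product[of p a c] \<open>0 < p\<close> unfolding s_def by auto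
  have uv: "0 < u" "0 < v" using assms by (auto simp: order_le_less)
  have "u = a + s \<and> v = c + s"
  proof (cases "0 \<le> s")
    case True
    then have "u \<le> a + s" "v \<le> c + s" using assms(5,6) unfolding s_def by auto
    then show ?thesis using factors_le_imp_eq[OF uv] prod assms(3) by simp
  next
    case False
    then have "a + s \<le> u" "c + s \<le> v" using assms(5,6) unfolding s_def by auto
    then show ?thesis using factors_le_imp_eq[OF pos] prod assms(3) by metis
  qed
  then show "u = a + shift a c p" "v = c + shift a c p" unfolding s_def by auto
qed

text \<open>
  The radicand \<open>(a + c)\<^sup>2 - 4 * a * c + 4 * p\<close> is \<open>(a - c)\<^sup>2 + 4 * p\<close>, so \<open>\<alpha>\<close> and \<open>\<beta>\<close> are the
  entries of the closest pair.
\<close>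

lemma \<alpha>_eq_shift: "\<alpha> S p i = a_b S i + shift (a_b S i) (a_w S i) p"
  and \<beta>_eq_shift: "\<beta> S p i = a_w S i + shift (a_b S i) (a_w S i) p"
proof -
  have "(a_b S i + a_w S i)\<^sup>2 - 4 * a_b S i * a_w S i + 4 * p = (a_b S i - a_w S i)\<^sup>2 + 4 * p"
    by (simp add: power2_eq_square algebra_simps)
  then show "\<alpha> S p i = a_b S i + shift (a_b S i) (a_w S i) p"
    and "\<beta> S p i = a_w S i + shift (a_b S i) (a_w S i) p"
    unfolding \<alpha>_def \<beta>_def shift_def by (simp_all add: field_simps)
qed

section \<open>Elementary facts about comparison systems\<close>

lemma valid_labels:
  assumes "valid_system S"
  shows "1 \<in> {1..num_best S}" "1 \<in> {1..num_worst S}"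
    and "2 \<in> {1..num_best S} \<or> 2 \<in> {1..num_worst S}"
    and "bst S ` {1..num_best S} \<subseteq> C S" "wst S ` {1..num_worst S} \<subseteq> C S"
    and "inj_on (bst S) {1..num_best S}" "inj_on (wst S) {1..num_worst S}"
    and "bst S ` {1..num_best S} \<inter> wst S ` {1..num_worst S} = {}"
proof -
  have "1 \<le> num_best S" "1 \<le> num_worst S" "2 \<le> num_best S \<or> 2 \<le> num_worst S"
    using assms by (simp_all only: valid_system_def)
  then show "1 \<in> {1..num_best S}" "1 \<in> {1..num_worst S}"
    and "2 \<in> {1..num_best S} \<or> 2 \<in> {1..num_worst S}"
    by auto
  show "bst S ` {1..num_best S} \<subseteq> C S" "wst S ` {1..num_worst S} \<subseteq> C S"
    "inj_on (bst S) {1..num_best S}" "inj_on (wst S) {1..num_worst S}"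
    "bst S ` {1..num_best S} \<inter> wst S ` {1..num_worst S} = {}"
    using assms by (simp_all only: valid_system_def)
qed

lemma criteria_facts:
  assumes "valid_system S"
  shows b_in_C: "b S \<in> C S" and w_in_C: "w S \<in> C S"
    and b_notin_D': "b S \<notin> D' S" and w_notin_D': "w S \<notin> D' S" and b_neq_w: "b S \<noteq> w S"
    and D'_subset_D: "D' S \<subseteq> D S"
proof -
  note L = valid_labels[OF assms]
  have b: "b S \<in> bst S ` {1..num_best S}" and w: "w S \<in> wst S ` {1..num_worst S}"
    using L(1,2) by blast+
  show "b S \<in> C S" "w S \<in> C S"
    using b w L(4,5) by blast+
  show "b S \<noteq> w S"
    using b w L(8) by (metis disjoint_iff)
  show "b S \<notin> D' S" "w S \<notin> D' S" "D' S \<subseteq> D S"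
    using b w unfolding D'_def D_def by blast+
qed

lemma D'_subset_C: "D' S \<subseteq> C S"
  unfolding D'_def by auto

lemma finite_D': "finite (D' S)"
  using finite_subset[OF D'_subset_C] unfolding C_def by simp

lemma pref_bounds:
  assumes "valid_system S" "i \<in> D S"
  shows "1 \<le> a_b S i" "1 \<le> a_w S i" "a_b S i \<le> a_bw S"
proof -
  have "\<forall>i\<in>D S. 1 \<le> a_b S i \<and> a_b S i \<le> a_bw S \<and> 1 \<le> a_w S i \<and> a_w S i \<le> a_bw S"
    using assms(1) unfolding valid_system_def by (elim conjE)
  then show "1 \<le> a_b S i" "1 \<le> a_w S i" "a_b S i \<le> a_bw S"
    using assms(2) by blast+
qed

text \<open>
  The bound is only given through the elements of \<open>D\<close>, so \<open>D\<close> must be nonempty: it contains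
  the second best or the second worst criterion.
\<close>

lemma a_bw_ge_1:
  assumes "valid_system S"
  shows "1 \<le> a_bw S"
proof -
  note L = valid_labels[OF assms]
  have b: "b S \<in> bst S ` {1..num_best S}" and w: "w S \<in> wst S ` {1..num_worst S}"
    using L(1,2) by blast+
  have "bst S 2 \<in> D S \<or> wst S 2 \<in> D S"
    using L(3)
  proof
    assume 2: "2 \<in> {1..num_best S}"
    have "bst S 2 \<noteq> b S" using inj_onD[OF L(6) _ 2 L(1)] by auto
    moreover have "bst S 2 \<noteq> w S" using imageI[OF 2, of "bst S"] w L(8) by (metis disjoint_iff)
    moreover have "bst S 2 \<in> C S" using imageI[OF 2, of "bst S"] L(4) by (rule subsetD[rotated])
    ultimately show ?thesis unfolding D_def by simp
  next
    assume 2: "2 \<in> {1..num_worst S}"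
    have "wst S 2 \<noteq> w S" using inj_onD[OF L(7) _ 2 L(2)] by auto
    moreover have "wst S 2 \<noteq> b S" using imageI[OF 2, of "wst S"] b L(8) by (metis disjoint_iff)
    moreover have "wst S 2 \<in> C S" using imageI[OF 2, of "wst S"] L(5) by (rule subsetD[rotated])
    ultimately show ?thesis unfolding D_def by simp
  qed
  then obtain i where i: "i \<in> D S" by blast
  show ?thesis using pref_bounds(1,3)[OF assms i] by simp
qed

text \<open>
  The criteria of \<open>D - D'\<close> have product \<open>a_bw\<close>. They are not constrained by the modification
  problem, but may occur as indices of \<open>eps2\<close>.
\<close>

lemma extra_best_or_worst:
  assumes "valid_system S" "i \<in> D S" "i \<notin> D' S"
  shows "(a_b S i = 1 \<and> a_w S i = a_bw S) \<or> (a_b S i = a_bw S \<and> a_w S i = 1)"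
proof -
  have "i \<in> bst S ` {1..num_best S} \<union> wst S ` {1..num_worst S}"
    using assms(2,3) unfolding D_def D'_def by blast
  moreover have "\<forall>k\<in>{1..num_best S}. a_b S (bst S k) = 1 \<and> a_w S (bst S k) = a_bw S"
    using assms(1) unfolding valid_system_def by (elim conjE)
  moreover have "\<forall>l\<in>{1..num_worst S}. a_w S (wst S l) = 1 \<and> a_b S (wst S l) = a_bw S"
    using assms(1) unfolding valid_system_def by (elim conjE)
  ultimately show ?thesis by blast
qed

section \<open>Modifications and weights\<close>

lemma mod_feasibleD:
  assumes "mod_feasible S u v p \<eta>"
  shows "\<bar>p - a_bw S\<bar> \<le> \<eta>" and "0 \<le> p" and "0 \<le> \<eta>"
    and "i \<in> D' S \<Longrightarrow> \<bar>u i - a_b S i\<bar> \<le> \<eta>" and "i \<in> D' S \<Longrightarrow> \<bar>v i - a_w S i\<bar> \<le> \<eta>"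
    and "i \<in> D' S \<Longrightarrow> u i * v i = p" and "i \<in> D' S \<Longrightarrow> 0 \<le> u i" and "i \<in> D' S \<Longrightarrow> 0 \<le> v i"
proof -
  show "\<bar>p - a_bw S\<bar> \<le> \<eta>" using assms unfolding mod_feasible_def by blast
  then show "0 \<le> \<eta>" by linarith
qed (use assms in \<open>unfold mod_feasible_def, blast+\<close>)

lemma mod_feasible_shift:
  "mod_feasible S (\<alpha> S p) (\<beta> S p) p \<eta> \<longleftrightarrow>
    0 \<le> p \<and> \<bar>p - a_bw S\<bar> \<le> \<eta> \<and> (\<forall>i\<in>D' S. \<bar>shift (a_b S i) (a_w S i) p\<bar> \<le> \<eta>)"
  unfolding mod_feasible_def
  by (auto simp: \<alpha>_eq_shift \<beta>_eq_shift shifted_product shifted_nonneg)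

lemma mod_feasible_imp_shift:
  assumes "mod_feasible S u v p \<eta>"
  shows "mod_feasible S (\<alpha> S p) (\<beta> S p) p \<eta>"
  unfolding mod_feasible_shift
proof (intro conjI ballI)
  show "0 \<le> p" "\<bar>p - a_bw S\<bar> \<le> \<eta>" by (rule mod_feasibleD[OF assms])+
next
  fix i assume i: "i \<in> D' S"
  show "\<bar>shift (a_b S i) (a_w S i) p\<bar> \<le> \<eta>"
    by (rule shift_minimal[OF mod_feasibleD(7,8,6,4,5)[OF assms i]])
qed

lemma weight_imp_mod_feasible:
  assumes "valid_system S" "weight_feasible S x e"
  shows "mod_feasible S (\<lambda>i. x (b S) / x i) (\<lambda>i. x i / x (w S)) (x (b S) / x (w S)) e"
proof -
  have nn: "0 \<le> x j" if "j \<in> C S" for j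
    using that assms(2) unfolding weight_feasible_def by auto
  have "0 \<le> x (b S)" "0 \<le> x (w S)" "\<And>i. i \<in> D' S \<Longrightarrow> 0 \<le> x i"
    using nn b_in_C[OF assms(1)] w_in_C[OF assms(1)] D'_subset_C by auto
  then show ?thesis using assms(2) unfolding weight_feasible_def mod_feasible_def by auto
qed

text \<open>
  Up to normalisation the weights are \<open>p\<close> for the best, \<open>1\<close> for the worst and \<open>v i\<close> for the other
  criteria. Positivity of \<open>p\<close> makes all \<open>v i\<close> nonzero, as the quotients require.
\<close>

lemma mod_imp_weight_feasible:
  assumes "valid_system S" "mod_feasible S u v p e" "0 < p"
  shows "\<exists>x. weight_feasible S x e"
proof -
  have v: "0 < v i" "p / v i = u i" if "i \<in> D' S" for i
  proof -
    have "u i * v i = p" "0 \<le> v i" using mod_feasibleD(6,8)[OF assms(2) that] by blast+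
    then show "0 < v i" "p / v i = u i" using assms(3) by (auto simp: order_le_less field_simps)
  qed
  define T where "T = real (num_best S) * p + real (num_worst S) + (\<Sum>i\<in>D' S. v i)"
  have nw: "1 \<le> real (num_worst S)" using valid_labels(2)[OF assms(1)] by simp
  have "0 \<le> real (num_best S) * p" "0 \<le> (\<Sum>i\<in>D' S. v i)"
    using assms(3) v by (auto intro!: sum_nonneg simp: less_imp_le)
  then have T: "0 < T" unfolding T_def using nw by linarith
  define x where "x i = (if i = b S then p / T else if i = w S then 1 / T
      else if i \<in> D' S then v i / T else 0)" for i
  have xb: "x (b S) = p / T" and xw: "x (w S) = 1 / T"
    using b_neq_w[OF assms(1)] unfolding x_def by auto
  have xi: "x i = v i / T" if "i \<in> D' S" for i
    using that b_notin_D'[OF assms(1)] w_notin_D'[OF assms(1)] unfolding x_def by auto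
  have "real (num_best S) * x (b S) + real (num_worst S) * x (w S) + (\<Sum>k\<in>D' S. x k)
      = (real (num_best S) * p + real (num_worst S) + (\<Sum>i\<in>D' S. v i)) / T"
    unfolding xb xw by (simp add: xi sum_divide_distrib[symmetric] add_divide_distrib)
  then have "real (num_best S) * x (b S) + real (num_worst S) * x (w S) + (\<Sum>k\<in>D' S. x k) = 1"
    using T unfolding T_def[symmetric] by simp
  moreover have "\<forall>j. 0 \<le> x j"
    unfolding x_def using assms(3) T v(1) by (auto simp: less_imp_le)
  moreover have "\<forall>i\<in>D' S. x i \<noteq> 0 \<and> x (b S) / x i = u i \<and> x i / x (w S) = v i"
  proof
    fix i assume i: "i \<in> D' S"
    show "x i \<noteq> 0 \<and> x (b S) / x i = u i \<and> x i / x (w S) = v i"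
      using T v[OF i] unfolding xi[OF i] xb xw by simp
  qed
  moreover have "x (w S) \<noteq> 0" "x (b S) / x (w S) = p" using T by (auto simp: xb xw)
  ultimately have "weight_feasible S x e"
    using assms(2) unfolding weight_feasible_def mod_feasible_def by auto
  then show ?thesis by blast
qed

section \<open>Existence of the optimum\<close>

text \<open>
  The function \<open>g\<close> is the pointwise maximum of \<open>g\<^sub>0\<close> and the \<open>f i\<close>. Characterising it by its upper
  bounds covers an empty index set without a separate case.
\<close>

lemma continuous_finite_max:
  fixes f :: "'i \<Rightarrow> real \<Rightarrow> real" and g\<^sub>0 :: "real \<Rightarrow> real"
  assumes "finite I" "continuous_on UNIV g\<^sub>0" "\<And>i. i \<in> I \<Longrightarrow> continuous_on UNIV (f i)"
  shows "\<exists>g. continuous_on UNIV g \<and> (\<forall>p \<eta>. g p \<le> \<eta> \<longleftrightarrow> g\<^sub>0 p \<le> \<eta> \<and> (\<forall>i\<in>I. f i p \<le> \<eta>))"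
  using assms(1,3)
proof (induction I)
  case empty
  then show ?case using assms(2) by (intro exI[of _ g\<^sub>0]) auto
next
  case (insert i I)
  then obtain g where "continuous_on UNIV g"
    "\<forall>p \<eta>. g p \<le> \<eta> \<longleftrightarrow> g\<^sub>0 p \<le> \<eta> \<and> (\<forall>i\<in>I. f i p \<le> \<eta>)" by auto
  with insert.prems show ?case
    by (intro exI[of _ "\<lambda>p. max (f i p) (g p)"]) (auto intro!: continuous_on_max)
qed

text \<open>
  For given \<open>p\<close> the least feasible value is the maximum \<open>G p\<close> of \<open>\<bar>p - a_bw S\<bar>\<close> and the absolute
  shifts, which is continuous in \<open>p\<close>. Below \<open>1\<close> the function \<open>G\<close> does not increase, because
  there all shifts are nonpositive and lowering \<open>p\<close> moves everything further away; for large \<open>p\<close>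
  the term \<open>\<bar>p - a_bw S\<bar>\<close> alone exceeds \<open>G (a_bw S)\<close>. So \<open>G\<close> attains its minimum at some \<open>p \<ge> 1\<close>.
\<close>

lemma optimum_exists:
  assumes "valid_system S"
  shows "\<exists>p \<eta>. 1 \<le> p \<and> mod_feasible S (\<alpha> S p) (\<beta> S p) p \<eta> \<and>
    (\<forall>u v q \<eta>'. mod_feasible S u v q \<eta>' \<longrightarrow> \<eta> \<le> \<eta>')"
proof -
  let ?s = "\<lambda>i. shift (a_b S i) (a_w S i)"
  have "\<exists>G. continuous_on UNIV G \<and>
      (\<forall>p \<eta>. G p \<le> \<eta> \<longleftrightarrow> \<bar>p - a_bw S\<bar> \<le> \<eta> \<and> (\<forall>i\<in>D' S. \<bar>?s i p\<bar> \<le> \<eta>))"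
    by (rule continuous_finite_max[OF finite_D']) (intro continuous_intros continuous_shift)+
  then obtain G where cont: "continuous_on UNIV G" and
    G: "\<And>p \<eta>. G p \<le> \<eta> \<longleftrightarrow> \<bar>p - a_bw S\<bar> \<le> \<eta> \<and> (\<forall>i\<in>D' S. \<bar>?s i p\<bar> \<le> \<eta>)"
    by metis
  have feas: "mod_feasible S (\<alpha> S p) (\<beta> S p) p \<eta> \<longleftrightarrow> 0 \<le> p \<and> G p \<le> \<eta>" for p \<eta>
    unfolding mod_feasible_shift G by simp
  have dev: "\<bar>p - a_bw S\<bar> \<le> G p" "i \<in> D' S \<Longrightarrow> \<bar>?s i p\<bar> \<le> G p" for p i
    using G[of p "G p"] by auto
  note bw = a_bw_ge_1[OF assms]
  (* To the right of M the distance to a_bw S is larger than G (a_bw S). *)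
  define M where "M = a_bw S + G (a_bw S)"
  have "0 \<le> G (a_bw S)" using dev(1)[of "a_bw S"] by simp
  then have M: "a_bw S \<in> {1..M}" using bw unfolding M_def by simp
  have "\<exists>p\<in>{1..M}. \<forall>q\<in>{1..M}. G p \<le> G q"
    using M by (intro continuous_attains_inf continuous_on_subset[OF cont]) auto
  then obtain p where p: "p \<in> {1..M}" and min: "\<And>q. q \<in> {1..M} \<Longrightarrow> G p \<le> G q" by auto
  have minimal: "G p \<le> G q" if "0 \<le> q" for q
  proof -
    consider "q < 1" | "q \<in> {1..M}" | "M < q" by force
    then show ?thesis
    proof cases
      case 1
      have "\<bar>?s i 1\<bar> \<le> G q" if i: "i \<in> D' S" for i
      proof -
        have "1 \<le> a_b S i" "1 \<le> a_w S i"
          using i D'_subset_D[OF assms] pref_bounds[OF assms] by auto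
        then have "1 \<le> a_b S i * a_w S i" "0 \<le> a_b S i" "0 \<le> a_w S i"
          using mult_mono[of 1 "a_b S i" 1 "a_w S i"] by auto
        then have "?s i 1 \<le> 0" by (intro shift_nonpos) auto
        moreover have "?s i q \<le> ?s i 1" using 1 by (intro shift_mono) simp
        ultimately show ?thesis using dev(2)[OF i, of q] by linarith
      qed
      moreover have "\<bar>1 - a_bw S\<bar> \<le> G q" using 1 bw dev(1)[of q] by linarith
      ultimately have "G 1 \<le> G q" unfolding G by blast
      then show ?thesis using min[of 1] M by auto
    next
      case 2
      then show ?thesis by (rule min)
    next
      case 3
      then have "G (a_bw S) \<le> G q" using dev(1)[of q] unfolding M_def by linarith
      then show ?thesis using min[OF M] by linarith
    qed
  qed
  show ?thesis
  proof (intro exI conjI allI impI)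
    show "1 \<le> p" using p by simp
    then show "mod_feasible S (\<alpha> S p) (\<beta> S p) p (G p)" unfolding feas by simp
  next
    fix u v q \<eta>' assume "mod_feasible S u v q \<eta>'"
    then have "0 \<le> q" "G q \<le> \<eta>'" using mod_feasible_imp_shift feas by blast+
    then show "G p \<le> \<eta>'" using minimal[of q] by linarith
  qed
qed

lemma eps_star_optimal:
  assumes "valid_system S"
  shows eps_star_attained:
      "\<exists>p. 1 \<le> p \<and> mod_feasible S (\<alpha> S p) (\<beta> S p) p (eps_star S)"
    and eps_star_le: "mod_feasible S u v q \<eta> \<Longrightarrow> eps_star S \<le> \<eta>"
proof -
  obtain p \<epsilon> where p: "1 \<le> p" and feas: "mod_feasible S (\<alpha> S p) (\<beta> S p) p \<epsilon>"
    and min: "\<And>u v q \<eta>. mod_feasible S u v q \<eta> \<Longrightarrow> \<epsilon> \<le> \<eta>"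
    using optimum_exists[OF assms] by blast
  have "eps_star S = \<epsilon>"
    unfolding eps_star_def
  proof (rule Least_equality)
    show "\<exists>x. weight_feasible S x \<epsilon>"
      using mod_imp_weight_feasible[OF assms feas] p by simp
  next
    fix e assume "\<exists>x. weight_feasible S x e"
    then show "\<epsilon> \<le> e" using weight_imp_mod_feasible[OF assms] min by blast
  qed
  then show "\<exists>p. 1 \<le> p \<and> mod_feasible S (\<alpha> S p) (\<beta> S p) p (eps_star S)"
    and "mod_feasible S u v q \<eta> \<Longrightarrow> eps_star S \<le> \<eta>"
    using p feas min by blast+
qed

lemma mod_optimal_eps_star:
  assumes "valid_system S"
  shows "mod_optimal S u v p \<eta> \<longleftrightarrow> \<eta> = eps_star S \<and> mod_feasible S u v p (eps_star S)"
proof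
  assume opt: "mod_optimal S u v p \<eta>"
  obtain q where "mod_feasible S (\<alpha> S q) (\<beta> S q) q (eps_star S)"
    using eps_star_attained[OF assms] by blast
  then have "\<eta> \<le> eps_star S" using opt unfolding mod_optimal_def by blast
  moreover have "eps_star S \<le> \<eta>" using opt eps_star_le[OF assms] unfolding mod_optimal_def by blast
  ultimately show "\<eta> = eps_star S \<and> mod_feasible S u v p (eps_star S)"
    using opt unfolding mod_optimal_def by simp
next
  assume "\<eta> = eps_star S \<and> mod_feasible S u v p (eps_star S)"
  then show "mod_optimal S u v p \<eta>"
    using eps_star_le[OF assms] unfolding mod_optimal_def by blast
qed

section \<open>A forced value of the best-to-worst comparison\<close>

lemma deviation_mk_system:
  assumes "valid_system S"
  shows "i \<in> D' S \<Longrightarrow>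
      deviation S (mk_system S u v p) i = max \<bar>u i - a_b S i\<bar> \<bar>v i - a_w S i\<bar>"
    and "deviation S (mk_system S u v p) (b S) = max \<bar>1 - a_b S (b S)\<bar> \<bar>p - a_bw S\<bar>"
    and "deviation S (mk_system S u v p) (w S) = max \<bar>p - a_bw S\<bar> \<bar>1 - a_w S (w S)\<bar>"
  using b_notin_D'[OF assms] w_notin_D'[OF assms] b_neq_w[OF assms]
  unfolding deviation_def mk_system_def idx_def by auto

lemma deviation_S':
  assumes "valid_system S" "i \<in> D' S"
  shows "deviation S (S' S p) i = \<bar>shift (a_b S i) (a_w S i) p\<bar>"
  unfolding S'_def using assms by (simp add: deviation_mk_system \<alpha>_eq_shift \<beta>_eq_shift)

text \<open>
  With \<open>p\<close> fixed, the deviations at \<open>b\<close> and \<open>w\<close> are the same for all optimally modified systems,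
  and at each criterion of \<open>D'\<close> the closest pair is the unique minimiser. The forced value is
  positive, as some optimum has \<open>p \<ge> 1\<close>.
\<close>

lemma only_best_if_forced:
  assumes "valid_system S"
    and forced: "\<And>u v p. mod_feasible S u v p (eps_star S) \<Longrightarrow> p = P"
  shows "only_best_optimally_modified S (S' S P)"
proof -
  note valid = assms(1)
  obtain q where "1 \<le> q" and "mod_feasible S (\<alpha> S q) (\<beta> S q) q (eps_star S)"
    using eps_star_attained[OF valid] by blast
  then have P: "1 \<le> P" and feas: "mod_feasible S (\<alpha> S P) (\<beta> S P) P (eps_star S)"
    using forced by auto
  have opt_iff: "optimally_modified S A \<longleftrightarrow>
      (\<exists>u v. mod_feasible S u v P (eps_star S) \<and> A = mk_system S u v P)" for A
    unfolding optimally_modified_def mod_optimal_eps_star[OF valid] using forced by blast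
  have opt: "optimally_modified S (S' S P)"
    unfolding opt_iff S'_def using feas by blast
  have le: "deviation S (S' S P) i \<le> deviation S A i"
    if "optimally_modified S A" "i \<in> idx S" for A i
  proof -
    obtain u v where f: "mod_feasible S u v P (eps_star S)" and A: "A = mk_system S u v P"
      using \<open>optimally_modified S A\<close> opt_iff by blast
    show ?thesis
    proof (cases "i \<in> D' S")
      case True
      have "\<bar>shift (a_b S i) (a_w S i) P\<bar> \<le> max \<bar>u i - a_b S i\<bar> \<bar>v i - a_w S i\<bar>"
        by (rule shift_minimal[OF mod_feasibleD(7,8,6)[OF f True]]) simp_all
      then show ?thesis using True valid by (simp add: A deviation_S' deviation_mk_system)
    next
      case False
      then have "i = b S \<or> i = w S" using \<open>i \<in> idx S\<close> unfolding idx_def by auto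
      then show ?thesis using valid by (auto simp: A S'_def deviation_mk_system)
    qed
  qed
  have best: "best_optimally_modified S (S' S P)"
    unfolding best_optimally_modified_def using opt le by blast
  have "A = S' S P" if A_best: "best_optimally_modified S A" for A
  proof -
    obtain u v where f: "mod_feasible S u v P (eps_star S)" and A: "A = mk_system S u v P"
      using A_best opt_iff unfolding best_optimally_modified_def by blast
    have uv: "u i = \<alpha> S P i \<and> v i = \<beta> S P i" if i: "i \<in> D' S" for i
    proof -
      have "deviation S A i \<le> deviation S (S' S P) i"
        using A_best opt i unfolding best_optimally_modified_def idx_def by blast
      then have "max \<bar>u i - a_b S i\<bar> \<bar>v i - a_w S i\<bar> \<le> \<bar>shift (a_b S i) (a_w S i) P\<bar>"
        using i valid by (simp add: A deviation_S' deviation_mk_system)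
      moreover have "u i * v i = P" "0 \<le> u i" "0 \<le> v i"
        using mod_feasibleD(6,7,8)[OF f i] by blast+
      ultimately show ?thesis
        unfolding \<alpha>_eq_shift \<beta>_eq_shift using P
        by (intro conjI shift_unique[of "u i" "v i"]) auto
    qed
    show ?thesis
      unfolding A S'_def mk_system_def idx_def using uv
      by (auto intro!: restrict_ext)
  qed
  with best show ?thesis unfolding only_best_optimally_modified_def by blast
qed

section \<open>Bounds that force the value\<close>

text \<open>
  For \<open>i\<close> in \<open>D'\<close> the bounds on the entries are multiplied. For the additional best and worst
  criteria, with entries \<open>1\<close> and \<open>a_bw S\<close>, the bound is weaker than \<open>p \<le> a_bw S + \<eta>\<close>.
  Treating them alike spares a case distinction on the indices of \<open>eps2\<close>.
\<close>

lemma feasible_le_upper: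
  assumes "valid_system S" "mod_feasible S u v p \<eta>" "i \<in> D S"
  shows "p \<le> (a_b S i + \<eta>) * (a_w S i + \<eta>)"
proof -
  note f = mod_feasibleD[OF assms(2)]
  note a = pref_bounds[OF assms(1,3)]
  show ?thesis
  proof (cases "i \<in> D' S")
    case True
    have "u i * v i \<le> (a_b S i + \<eta>) * (a_w S i + \<eta>)"
      using f(3) f(4,5,7,8)[OF True] a by (intro mult_mono) linarith+
    then show ?thesis using f(6)[OF True] by simp
  next
    case False
    have "p \<le> 1 * (a_bw S + \<eta>)" using f(1) by simp
    also have "\<dots> \<le> (1 + \<eta>) * (a_bw S + \<eta>)"
      using f(3) a_bw_ge_1[OF assms(1)] by (intro mult_right_mono) linarith+
    finally show ?thesis
      using extra_best_or_worst[OF assms(1,3) False] by (auto simp only: mult.commute)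
  qed
qed

text \<open>
  The hypotheses on \<open>\<eta>\<close> make the factors on the left nonnegative; otherwise their product
  need not be a lower bound.
\<close>

lemma feasible_ge_lower:
  assumes "valid_system S" "mod_feasible S u v p \<eta>" "i \<in> D S"
    and "\<eta> \<le> a_b S i" "\<eta> \<le> a_w S i"
  shows "(a_b S i - \<eta>) * (a_w S i - \<eta>) \<le> p"
proof -
  note f = mod_feasibleD[OF assms(2)]
  show ?thesis
  proof (cases "i \<in> D' S")
    case True
    have "(a_b S i - \<eta>) * (a_w S i - \<eta>) \<le> u i * v i"
      using f(4,5,7,8)[OF True] assms(4,5) by (intro mult_mono) linarith+
    then show ?thesis using f(6)[OF True] by simp
  next
    case False
    note e = extra_best_or_worst[OF assms(1,3) False]
    then have "\<eta> \<le> a_bw S" using assms(4,5) by auto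
    then have "(1 - \<eta>) * (a_bw S - \<eta>) \<le> 1 * (a_bw S - \<eta>)"
      using f(3) by (intro mult_right_mono) linarith+
    also have "\<dots> \<le> p" using f(1) by simp
    finally show ?thesis using e by (auto simp only: mult.commute)
  qed
qed

text \<open>
  Here the difference in the definition of \<open>eps1\<close> is nonpositive, and its absolute value is the
  nonnegative root of the quadratic equation obtained by expanding the claim.
\<close>

lemma eps1_D\<^sub>1:
  assumes "i \<in> D\<^sub>1 S" "valid_system S"
  shows "(a_b S i + eps1 S i) * (a_w S i + eps1 S i) = a_bw S - eps1 S i"
proof -
  define s where "s = a_b S i + a_w S i + 1"
  define d where "d = a_b S i * a_w S i - a_bw S"
  define r where "r = sqrt (s\<^sup>2 - 4 * d)"
  have "i \<in> D S" and d: "d < 0" using assms(1) unfolding D\<^sub>1_def d_def by auto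
  then have "0 \<le> s" using pref_bounds[OF assms(2)] unfolding s_def by fastforce
  then have "s \<le> r" unfolding r_def using d by (intro real_le_rsqrt) auto
  then have e: "eps1 S i = (r - s) / 2"
    unfolding eps1_def s_def[symmetric] d_def[symmetric] r_def[symmetric] by simp
  have "0 \<le> s\<^sup>2 - 4 * d" using d zero_le_power2[of s] by linarith
  then have "r\<^sup>2 = s\<^sup>2 - 4 * d" unfolding r_def by simp
  then have "(eps1 S i)\<^sup>2 + s * eps1 S i + d = 0"
    unfolding e by (simp add: field_simps power2_eq_square)
  then show ?thesis unfolding s_def d_def by (simp add: algebra_simps power2_eq_square)
qed

text \<open>
  Now \<open>eps1\<close> is the smaller root of the corresponding quadratic equation. Its being at most both
  entries amounts to the square root being at least \<open>\<bar>a_b S i - a_w S i\<bar> + 1\<close>.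
\<close>

lemma eps1_D\<^sub>2:
  assumes "i \<in> D\<^sub>2 S" "valid_system S"
  shows "(a_b S i - eps1 S i) * (a_w S i - eps1 S i) = a_bw S + eps1 S i"
    and "eps1 S i \<le> a_b S i" "eps1 S i \<le> a_w S i"
proof -
  define s where "s = a_b S i + a_w S i + 1"
  define d where "d = a_b S i * a_w S i - a_bw S"
  define r where "r = sqrt (s\<^sup>2 - 4 * d)"
  have iD: "i \<in> D S" and d: "0 < d" using assms(1) unfolding D\<^sub>2_def d_def by auto
  note a = pref_bounds[OF assms(2) iD] and bw = a_bw_ge_1[OF assms(2)]
  have s: "0 \<le> s" using a unfolding s_def by simp
  have disc: "s\<^sup>2 - 4 * d = (a_b S i - a_w S i)\<^sup>2 + (2 * a_b S i + 2 * a_w S i + 1 + 4 * a_bw S)"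
    unfolding s_def d_def by (simp add: power2_eq_square algebra_simps)
  have "(\<bar>a_b S i - a_w S i\<bar> + 1)\<^sup>2 = (a_b S i - a_w S i)\<^sup>2 + (2 * \<bar>a_b S i - a_w S i\<bar> + 1)"
    by (simp add: power2_sum)
  also have "\<dots> \<le> s\<^sup>2 - 4 * d"
    unfolding disc using a bw by (intro add_left_mono) (simp add: abs_if)
  finally have gap: "(\<bar>a_b S i - a_w S i\<bar> + 1)\<^sup>2 \<le> s\<^sup>2 - 4 * d" .
  moreover have "r \<le> s" unfolding r_def using d s by (intro real_le_lsqrt) auto
  moreover have "0 \<le> s\<^sup>2 - 4 * d" using gap by (rule order_trans[OF zero_le_power2])
  ultimately have r: "\<bar>a_b S i - a_w S i\<bar> + 1 \<le> r" "r \<le> s" "r\<^sup>2 = s\<^sup>2 - 4 * d"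
    unfolding r_def by (auto intro: real_le_rsqrt)
  then have e: "eps1 S i = (s - r) / 2"
    unfolding eps1_def s_def[symmetric] d_def[symmetric] r_def[symmetric] by simp
  have "(eps1 S i)\<^sup>2 - s * eps1 S i + d = 0"
    unfolding e using r(3) by (simp add: field_simps power2_eq_square)
  then show "(a_b S i - eps1 S i) * (a_w S i - eps1 S i) = a_bw S + eps1 S i"
    unfolding s_def d_def by (simp add: algebra_simps power2_eq_square)
  show "eps1 S i \<le> a_b S i" "eps1 S i \<le> a_w S i"
    unfolding e s_def using r(1) by (simp_all add: abs_if split: if_splits)
qed

text \<open>
  The quadratic terms of the two products cancel, so the equation is linear in \<open>eps2\<close>. The order
  of the two indices decides the sign of the fraction inside the absolute value.
\<close>

lemma eps2_ordered:
  assumes "valid_system S" "i \<in> D S" "j \<in> D S" "a_b S i * a_w S i \<le> a_b S j * a_w S j"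
  shows "(a_b S i + eps2 S i j) * (a_w S i + eps2 S i j)
      = (a_b S j - eps2 S i j) * (a_w S j - eps2 S i j)"
    and "eps2 S i j \<le> a_b S j" "eps2 S i j \<le> a_w S j"
proof -
  note a = pref_bounds[OF assms(1,2)] pref_bounds[OF assms(1,3)]
  define s where "s = a_b S i + a_w S i + a_b S j + a_w S j"
  have s: "0 < s" using a unfolding s_def by simp
  have e: "eps2 S i j = (a_b S j * a_w S j - a_b S i * a_w S i) / s"
    unfolding eps2_def s_def[symmetric] using s assms(4) by (simp add: abs_divide)
  then have "eps2 S i j * s = a_b S j * a_w S j - a_b S i * a_w S i" using s by simp
  then show "(a_b S i + eps2 S i j) * (a_w S i + eps2 S i j)
      = (a_b S j - eps2 S i j) * (a_w S j - eps2 S i j)"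
    unfolding s_def by (simp add: algebra_simps)
  have "a_b S j * a_w S j - a_b S i * a_w S i \<le> a_b S j * a_w S j"
    using a by simp
  moreover have "a_b S j * a_w S j \<le> a_b S j * s" "a_w S j * a_b S j \<le> a_w S j * s"
    using a unfolding s_def by (intro mult_left_mono; simp)+
  ultimately show "eps2 S i j \<le> a_b S j" "eps2 S i j \<le> a_w S j"
    unfolding e using s by (simp_all add: pos_divide_le_eq mult.commute)
qed

theorem theorem5:
  fixes S :: comparison_system
  assumes "valid_system S"
  shows "(\<forall>i\<^sub>0\<in>D\<^sub>1 S. eps_star S = eps1 S i\<^sub>0 \<longrightarrow>
            only_best_optimally_modified S (S' S (a_bw S - eps1 S i\<^sub>0)))
       \<and> (\<forall>j\<^sub>0\<in>D\<^sub>2 S. eps_star S = eps1 S j\<^sub>0 \<longrightarrow>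
            only_best_optimally_modified S (S' S (a_bw S + eps1 S j\<^sub>0)))
       \<and> (\<forall>i\<^sub>0\<in>D S. \<forall>j\<^sub>0\<in>D S.
            a_b S i\<^sub>0 * a_w S i\<^sub>0 \<le> a_b S j\<^sub>0 * a_w S j\<^sub>0 \<longrightarrow> eps_star S = eps2 S i\<^sub>0 j\<^sub>0 \<longrightarrow>
            only_best_optimally_modified S
              (S' S ((a_b S i\<^sub>0 + eps2 S i\<^sub>0 j\<^sub>0) * (a_w S i\<^sub>0 + eps2 S i\<^sub>0 j\<^sub>0))))"
proof (intro conjI ballI impI)
  note valid = assms
  fix i assume i: "i \<in> D\<^sub>1 S" and star: "eps_star S = eps1 S i"
  show "only_best_optimally_modified S (S' S (a_bw S - eps1 S i))"
  proof (rule only_best_if_forced[OF valid])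
    fix u v p assume f: "mod_feasible S u v p (eps_star S)"
    have "p \<le> a_bw S - eps1 S i"
      using feasible_le_upper[OF valid f, of i] i eps1_D\<^sub>1[OF i valid] star
      unfolding D\<^sub>1_def by simp
    moreover have "a_bw S - eps1 S i \<le> p" using mod_feasibleD(1)[OF f] star by linarith
    ultimately show "p = a_bw S - eps1 S i" by simp
  qed
next
  note valid = assms
  fix j assume j: "j \<in> D\<^sub>2 S" and star: "eps_star S = eps1 S j"
  show "only_best_optimally_modified S (S' S (a_bw S + eps1 S j))"
  proof (rule only_best_if_forced[OF valid])
    fix u v p assume f: "mod_feasible S u v p (eps_star S)"
    have "a_bw S + eps1 S j \<le> p"
      using feasible_ge_lower[OF valid f, of j] j eps1_D\<^sub>2[OF j valid] star
      unfolding D\<^sub>2_def by simp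
    moreover have "p \<le> a_bw S + eps1 S j" using mod_feasibleD(1)[OF f] star by linarith
    ultimately show "p = a_bw S + eps1 S j" by simp
  qed
next
  note valid = assms
  fix i j assume D: "i \<in> D S" "j \<in> D S" and le: "a_b S i * a_w S i \<le> a_b S j * a_w S j"
    and star: "eps_star S = eps2 S i j"
  show "only_best_optimally_modified S
      (S' S ((a_b S i + eps2 S i j) * (a_w S i + eps2 S i j)))"
  proof (rule only_best_if_forced[OF valid])
    fix u v p assume f: "mod_feasible S u v p (eps_star S)"
    show "p = (a_b S i + eps2 S i j) * (a_w S i + eps2 S i j)"
      using feasible_le_upper[OF valid f D(1)] feasible_ge_lower[OF valid f D(2)]
        eps2_ordered[OF valid D le] star by simp
  qed
qed

end
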